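(* Let $J$ be a Jacobi operator on $\ell^2(\mathbb{Z}^\nu)$ with bounded parameters $\{a_{\ell m}\},\{b_\ell\}$. Suppose $u=(u_\ell)_{\ell\in\mathbb{Z}^\nu}$ is a family of positive numbers such that $$\sum_{m:\,|m-\ell|=1}a_{\ell m}u_m+b_\ell u_\ell=0\qquad\text{for all }\ell\in\mathbb{Z}^\nu.$$ Then for any real-valued $f$ on $\mathbb{Z}^\nu$ with $fu\in\ell^2(\mathbb{Z}^\nu)$, $$\langle fu,(-J)fu\rangle=\sum_{\{\ell,m\}:\,|m-\ell|=1}a_{\ell m}u_\ell u_m(f_\ell-f_m)^2,$$ where the sum is over unordered nearest-neighbor pairs (each pair $\{\ell,m\}$ counted once).
   Context: A Jacobi operator on $\mathbb{Z}^\nu$ is parametrized by symmetric $a_{\ell m}=a_{m\ell}>0$ for $\ell,m\in\mathbb{Z}^\nu$ with $|\ell-m|=1$ (nearest neighbors, i.e. $m=\ell\pm\delta_j$ with $\delta_j$ the $j$-th standard basis vector, $j=1,\dots,\nu$) and real $b_\ell$, $\ell\in\mathbb{Z}^\nu$, with $\sup|b_\ell|+\sup|a_{\ell m}|<\infty$. It is the bounded operator on $\ell^2(\mathbb{Z}^\nu)$ $$(J\varphi)_\ell=\sum_{m:\,|m-\ell|=1}a_{\ell m}\varphi_m+b_\ell\varphi_\ell .$$ The sequence $u$ need not be in $\ell^2$, and $(fu)_\ell=f_\ell u_\ell$. *)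

theory Defs
  imports "HOL-Analysis.Analysis"
begin

text \<open>The lattice of dimension \<open>\<nu> = CARD('n)\<close> is the type \<open>int ^ 'n\<close>.\<close>

definition nearest_neighbor :: "int ^ 'n \<Rightarrow> int ^ 'n \<Rightarrow> bool" where
  "nearest_neighbor l m \<longleftrightarrow> (\<exists>j. m = l + axis j 1 \<or> m = l - axis j 1)"

definition nn_pairs :: "(int ^ 'n) set set" where
  "nn_pairs = {{l, m} | l m. nearest_neighbor l m}"

text \<open>The value of a symmetric expression \<open>g l m\<close> at the unordered pair \<open>{l, m}\<close>.
  It is meaningful only if \<open>g l m = g m l\<close>; see \<open>pair_value_eq\<close> below.\<close>

definition pair_value :: "('a \<Rightarrow> 'a \<Rightarrow> 'b) \<Rightarrow> 'a set \<Rightarrow> 'b" where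
  "pair_value g e = (THE t. \<forall>l m. e = {l, m} \<longrightarrow> t = g l m)"

text \<open>Only the values of \<open>a\<close> at nearest neighbors are parameters; the others are
  arbitrary and never used.\<close>

definition jacobi_parameters :: "(int ^ 'n \<Rightarrow> int ^ 'n \<Rightarrow> real) \<Rightarrow> (int ^ 'n \<Rightarrow> real) \<Rightarrow> bool" where
  "jacobi_parameters a b \<longleftrightarrow>
     (\<forall>l m. nearest_neighbor l m \<longrightarrow> a l m = a m l \<and> a l m > 0) \<and>
     bounded {a l m | l m. nearest_neighbor l m} \<and>
     bounded (range b)"

definition ell2 :: "('i \<Rightarrow> complex) set" where
  "ell2 = {\<phi>. (\<lambda>l. (cmod (\<phi> l))\<^sup>2) summable_on UNIV}"

definition ell2_inner :: "('i \<Rightarrow> complex) \<Rightarrow> ('i \<Rightarrow> complex) \<Rightarrow> complex" where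
  "ell2_inner \<phi> \<psi> = (\<Sum>\<^sub>\<infinity>l. cnj (\<phi> l) * \<psi> l)"

text \<open>The formula makes sense for arbitrary sequences; as an operator it is considered on
  \<open>ell2\<close>, which it maps to itself by \<open>jacobi_op_in_ell2\<close>.\<close>

definition jacobi_op ::
  "(int ^ 'n \<Rightarrow> int ^ 'n \<Rightarrow> real) \<Rightarrow> (int ^ 'n \<Rightarrow> real) \<Rightarrow> (int ^ 'n \<Rightarrow> complex) \<Rightarrow> int ^ 'n \<Rightarrow> complex"
  where
  "jacobi_op a b \<phi> l =
     (\<Sum>m | nearest_neighbor l m. of_real (a l m) * \<phi> m) + of_real (b l) * \<phi> l"

lemma nearest_neighbor_sym: "nearest_neighbor l m \<longleftrightarrow> nearest_neighbor m l"
proof -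
  have "m = l + x \<longleftrightarrow> l = m - x" "m = l - x \<longleftrightarrow> l = m + x" for x
    by auto
  then show ?thesis unfolding nearest_neighbor_def by blast
qed

lemma nearest_neighbor_neq: "nearest_neighbor l m \<Longrightarrow> l \<noteq> m"
  by (auto simp: nearest_neighbor_def axis_eq_0_iff)

lemma neighbors_eq: "{m. nearest_neighbor l m} = (\<lambda>d. l + d) ` {d. nearest_neighbor 0 d}"
proof -
  have shift: "nearest_neighbor l (l + d) \<longleftrightarrow> nearest_neighbor 0 d" for d
    by (simp add: nearest_neighbor_def diff_conv_add_uminus del: add_uminus_conv_diff)
  show ?thesis
  proof (intro equalityI subsetI)
    fix m assume "m \<in> {m. nearest_neighbor l m}"
    then have "m - l \<in> {d. nearest_neighbor 0 d}"
      using shift[of "m - l"] by simp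
    then show "m \<in> (\<lambda>d. l + d) ` {d. nearest_neighbor 0 d}"
      by (rule rev_image_eqI) simp
  qed (use shift in blast)
qed

lemma finite_neighbors: "finite {m. nearest_neighbor l m}"
proof -
  have "{m. nearest_neighbor l m} = range (\<lambda>j. l + axis j 1) \<union> range (\<lambda>j. l - axis j 1)"
    by (auto simp: nearest_neighbor_def)
  then show ?thesis by simp
qed

lemma pair_value_eq:
  assumes "g l m = g m l"
  shows "pair_value g {l, m} = g l m"
  unfolding pair_value_def using assms by (intro the_equality) (auto simp: doubleton_eq_iff)

lemma ell2_inner_summable:
  assumes "\<phi> \<in> ell2" "\<psi> \<in> ell2"
  shows "(\<lambda>l. cnj (\<phi> l) * \<psi> l) summable_on UNIV"
proof (rule abs_summable_summable, rule summable_on_comparison_test)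
  show "(\<lambda>l. (cmod (\<phi> l))\<^sup>2 + (cmod (\<psi> l))\<^sup>2) summable_on UNIV"
    using assms by (intro summable_on_add) (auto simp: ell2_def)
  show "norm (cnj (\<phi> l) * \<psi> l) \<le> (cmod (\<phi> l))\<^sup>2 + (cmod (\<psi> l))\<^sup>2" for l
  proof -
    have "2 * (cmod (\<phi> l) * cmod (\<psi> l)) \<le> (cmod (\<phi> l))\<^sup>2 + (cmod (\<psi> l))\<^sup>2"
      using sum_squares_bound[of "cmod (\<phi> l)" "cmod (\<psi> l)"] by simp
    moreover have "0 \<le> cmod (\<phi> l) * cmod (\<psi> l)" by simp
    ultimately show ?thesis unfolding norm_mult complex_mod_cnj by linarith
  qed
qed auto

lemma ell2_add:
  assumes "\<phi> \<in> ell2" "\<psi> \<in> ell2"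
  shows "(\<lambda>l. \<phi> l + \<psi> l) \<in> ell2"
  unfolding ell2_def mem_Collect_eq
proof (rule summable_on_comparison_test)
  show "(\<lambda>l. 2 * (cmod (\<phi> l))\<^sup>2 + 2 * (cmod (\<psi> l))\<^sup>2) summable_on UNIV"
    using assms by (intro summable_on_add summable_on_cmult_right) (auto simp: ell2_def)
  show "(cmod (\<phi> l + \<psi> l))\<^sup>2 \<le> 2 * (cmod (\<phi> l))\<^sup>2 + 2 * (cmod (\<psi> l))\<^sup>2" for l
  proof -
    have "(cmod (\<phi> l + \<psi> l))\<^sup>2 \<le> (cmod (\<phi> l) + cmod (\<psi> l))\<^sup>2"
      by (intro power_mono norm_triangle_ineq) auto
    then show ?thesis
      using sum_squares_bound[of "cmod (\<phi> l)" "cmod (\<psi> l)"] by (simp add: power2_sum)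
  qed
qed auto

lemma ell2_sum:
  assumes "finite D" "\<And>d. d \<in> D \<Longrightarrow> \<phi> d \<in> ell2"
  shows "(\<lambda>l. \<Sum>d\<in>D. \<phi> d l) \<in> ell2"
  using assms
proof (induction D rule: finite_induct)
  case empty
  show ?case by (simp add: ell2_def)
next
  case (insert d D)
  then show ?case using ell2_add[of "\<phi> d" "\<lambda>l. \<Sum>d\<in>D. \<phi> d l"] by simp
qed

lemma ell2_mult_bounded:
  assumes "\<phi> \<in> ell2" "\<And>l. \<bar>c l\<bar> \<le> K"
  shows "(\<lambda>l. of_real (c l) * \<phi> l) \<in> ell2"
  unfolding ell2_def mem_Collect_eq
proof (rule summable_on_comparison_test)
  show "(\<lambda>l. K\<^sup>2 * (cmod (\<phi> l))\<^sup>2) summable_on UNIV"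
    using assms by (intro summable_on_cmult_right) (auto simp: ell2_def)
  show "(cmod (of_real (c l) * \<phi> l))\<^sup>2 \<le> K\<^sup>2 * (cmod (\<phi> l))\<^sup>2" for l
    using power_mono[OF assms(2)[of l] abs_ge_zero, of 2]
    by (auto simp: norm_mult power_mult_distrib intro: mult_right_mono)
qed auto

lemma ell2_shift:
  fixes \<phi> :: "int ^ 'n \<Rightarrow> complex"
  assumes "\<phi> \<in> ell2"
  shows "(\<lambda>l. \<phi> (l + d)) \<in> ell2"
proof -
  have "bij (\<lambda>l::int ^ 'n. l + d)"
    by (rule bij_betw_byWitness[where f' = "\<lambda>l. l - d"]) auto
  from summable_on_reindex_bij_betw[OF this, of "\<lambda>l. (cmod (\<phi> l))\<^sup>2"] assms
  show ?thesis by (simp add: ell2_def)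
qed

lemma jacobi_op_in_ell2:
  fixes \<phi> :: "int ^ 'n \<Rightarrow> complex"
  assumes "jacobi_parameters a b" "\<phi> \<in> ell2"
  shows "jacobi_op a b \<phi> \<in> ell2"
proof -
  let ?D = "{d :: int ^ 'n. nearest_neighbor 0 d}"
  obtain A where A: "nearest_neighbor l m \<Longrightarrow> \<bar>a l m\<bar> \<le> A" for l m
    using assms(1) by (fastforce simp: jacobi_parameters_def bounded_iff)
  obtain B where B: "\<bar>b l\<bar> \<le> B" for l
    using assms(1) by (fastforce simp: jacobi_parameters_def bounded_iff)
  have "jacobi_op a b \<phi> =
      (\<lambda>l. (\<Sum>d\<in>?D. of_real (a l (l + d)) * \<phi> (l + d)) + of_real (b l) * \<phi> l)"
  proof
    fix l
    show "jacobi_op a b \<phi> l =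
        (\<Sum>d\<in>?D. of_real (a l (l + d)) * \<phi> (l + d)) + of_real (b l) * \<phi> l"
      unfolding jacobi_op_def by (subst neighbors_eq, subst sum.reindex) auto
  qed
  moreover have "(\<lambda>l. of_real (a l (l + d)) * \<phi> (l + d)) \<in> ell2" if "d \<in> ?D" for d
  proof (rule ell2_mult_bounded)
    show "\<bar>a l (l + d)\<bar> \<le> A" for l
      using that neighbors_eq[of l] by (intro A) blast
  qed (rule ell2_shift[OF assms(2)])
  then have "(\<lambda>l. \<Sum>d\<in>?D. of_real (a l (l + d)) * \<phi> (l + d)) \<in> ell2"
    by (rule ell2_sum[OF finite_neighbors])
  then have "(\<lambda>l. (\<Sum>d\<in>?D. of_real (a l (l + d)) * \<phi> (l + d)) + of_real (b l) * \<phi> l) \<in> ell2"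
    by (rule ell2_add) (rule ell2_mult_bounded[OF assms(2) B])
  ultimately show ?thesis by simp
qed

end

theory Submission
  imports Defs
begin

text \<open>Write \<open>g = f u\<close>. For an edge \<open>{l, m}\<close>,
  \<open>a l m * u l * u m * (f l - f m)\<^sup>2 = a l m * u l * u m * (f l)\<^sup>2 + a l m * u l * u m * (f m)\<^sup>2 - 2 * a l m * g l * g m\<close>.
  Sum this over all ordered pairs of neighbors. The first two terms are exchanged by
  \<open>(l, m) \<mapsto> (m, l)\<close>, so they contribute the same amount, and the sum over \<open>m\<close> of the first is
  \<open>f l * g l * (\<Sum>m. a l m * u m) = - b l * (g l)\<^sup>2\<close> by the equation for \<open>u\<close>. The last term gives
  the off-diagonal part of \<open>J\<close>. Altogether the sum over ordered pairs is \<open>2 * \<langle>g, - J g\<rangle>\<close>, and each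
  unordered pair has been counted twice.

  The point that needs care is convergence: \<open>u\<close> and \<open>f\<close> may be unbounded, and since \<open>a\<close> may
  come arbitrarily close to \<open>0\<close>, the ratios \<open>u m / u l\<close> may be unbounded as well. Positivity
  replaces such bounds. The terms \<open>a l m * u l * u m * (f l)\<^sup>2\<close> are nonnegative and their sums over
  \<open>m\<close>, being \<open>- b l * (g l)\<^sup>2\<close>, are summable in \<open>l\<close>; so they are summable over ordered pairs, and
  the mixed terms are dominated by them through the arithmetic-geometric mean inequality. This
  argument works on any locally finite graph and is carried out there in
  \<open>ground_state_ordered_pairs\<close>; the passage to unordered pairs is \<open>has_sum_unordered_pairs\<close>.\<close>

text \<open>Both sums arise from the family \<open>(e, l) \<mapsto> G e\<close>, where \<open>e\<close> is an edge and \<open>l\<close> one of its two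
  endpoints: such a flag is the same thing as an ordered pair, and summing over the endpoints first
  doubles the value at each edge.\<close>

lemma has_sum_unordered_pairs:
  fixes G :: "'i \<Rightarrow> 'i \<Rightarrow> real"
  assumes sym: "\<And>l m. R l m \<Longrightarrow> R m l"
    and irrefl: "\<And>l. \<not> R l l"
    and G_sym: "\<And>l m. R l m \<Longrightarrow> G l m = G m l"
    and sum: "((\<lambda>(l, m). G l m) has_sum 2 * T) (SIGMA l:UNIV. {m. R l m})"
  shows "(pair_value G has_sum T) {{l, m} | l m. R l m}"
proof -
  let ?P = "SIGMA l:UNIV. {m. R l m}" and ?E = "{{l, m} | l m. R l m}"
  have bij: "bij_betw (\<lambda>(l, m). ({l, m}, l)) ?P (Sigma ?E (\<lambda>e. e))"
    unfolding bij_betw_def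
  proof (intro conjI equalityI subsetI)
    show "inj_on (\<lambda>(l, m). ({l, m}, l)) ?P"
      by (auto simp: inj_on_def doubleton_eq_iff)
    show "x \<in> Sigma ?E (\<lambda>e. e)" if "x \<in> (\<lambda>(l, m). ({l, m}, l)) ` ?P" for x
      using that by auto
    fix x assume "x \<in> Sigma ?E (\<lambda>e. e)"
    then obtain l m k where x: "x = ({l, m}, k)" "R l m" "k = l \<or> k = m" by auto
    then have "x = ({l, m}, l) \<and> R l m \<or> x = ({m, l}, m) \<and> R m l"
      using sym by auto
    then show "x \<in> (\<lambda>(l, m). ({l, m}, l)) ` ?P" by force
  qed
  have edge_value: "pair_value G {l, m} = G l m" if "R l m" for l m
    by (rule pair_value_eq) (rule G_sym[OF that])
  have "((\<lambda>p. (\<lambda>(e, l). pair_value G e) ((\<lambda>(l, m). ({l, m}, l)) p)) has_sum 2 * T) ?P"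
    using sum by (rule has_sum_cong[THEN iffD1, rotated]) (auto simp: edge_value)
  then have flags: "((\<lambda>(e, l). pair_value G e) has_sum 2 * T) (Sigma ?E (\<lambda>e. e))"
    using has_sum_reindex_bij_betw[OF bij, of "\<lambda>(e, l). pair_value G e"] by simp
  have "((\<lambda>l. (\<lambda>(e, l). pair_value G e) (e, l)) has_sum 2 * pair_value G e) e" if "e \<in> ?E" for e
  proof -
    obtain l m where e: "e = {l, m}" "R l m" using \<open>e \<in> ?E\<close> by blast
    with irrefl have "l \<noteq> m" by auto
    with e show ?thesis by (intro has_sum_finiteI) auto
  qed
  with flags have "((\<lambda>e. 2 * pair_value G e) has_sum 2 * T) ?E"
    by (rule has_sum_SigmaD)
  then show ?thesis by (simp add: has_sum_cmult_right_iff)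
qed

text \<open>In the proof, \<open>A\<close> and \<open>A'\<close> collect the two diagonal terms of the expanded square and \<open>C\<close> half
  of the mixed one. The equation for \<open>u\<close> turns each row sum of \<open>A\<close> into minus the potential energy
  \<open>b l * (f l * u l)\<^sup>2\<close>, so nonnegativity makes summability of the latter control the whole double
  sum. With \<open>V\<close> the total potential energy and \<open>S\<close> the sum of \<open>C\<close>, the common value is
  \<open>T = - (S + V)\<close>.\<close>

lemma ground_state_ordered_pairs:
  fixes a :: "'i \<Rightarrow> 'i \<Rightarrow> real" and b u f :: "'i \<Rightarrow> real"
  assumes sym: "\<And>l m. R l m \<Longrightarrow> R m l"
    and fin: "\<And>l. finite {m. R l m}"
    and a_sym: "\<And>l m. R l m \<Longrightarrow> a l m = a m l"
    and a_nonneg: "\<And>l m. R l m \<Longrightarrow> 0 \<le> a l m"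
    and u_nonneg: "\<And>l. 0 \<le> u l"
    and eqn: "\<And>l. (\<Sum>m | R l m. a l m * u m) + b l * u l = 0"
    and pot: "(\<lambda>l. b l * (f l * u l)\<^sup>2) summable_on UNIV"
  obtains T where
    "((\<lambda>l. - (f l * u l * ((\<Sum>m | R l m. a l m * (f m * u m)) + b l * (f l * u l)))) has_sum T) UNIV"
    "((\<lambda>(l, m). a l m * u l * u m * (f l - f m)\<^sup>2) has_sum 2 * T) (SIGMA l:UNIV. {m. R l m})"
proof -
  let ?P = "SIGMA l:UNIV. {m. R l m}"
  define A where "A = (\<lambda>(l, m). a l m * u l * u m * (f l)\<^sup>2)"
  define A' where "A' = (\<lambda>(l, m). a l m * u l * u m * (f m)\<^sup>2)"
  define C where "C = (\<lambda>(l, m). a l m * (f l * u l) * (f m * u m))"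
  define V where "V = infsum (\<lambda>l. b l * (f l * u l)\<^sup>2) UNIV"
  have V: "((\<lambda>l. b l * (f l * u l)\<^sup>2) has_sum V) UNIV"
    unfolding V_def using pot by simp
  have fibre: "((\<lambda>m. A (l, m)) has_sum - (b l * (f l * u l)\<^sup>2)) {m. R l m}" for l
  proof (rule has_sum_finiteI[OF fin])
    have "(\<Sum>m | R l m. A (l, m)) = u l * (f l)\<^sup>2 * (\<Sum>m | R l m. a l m * u m)"
      by (simp add: A_def sum_distrib_left mult_ac)
    also have "(\<Sum>m | R l m. a l m * u m) = - (b l * u l)"
      using eqn[of l] by linarith
    finally show "- (b l * (f l * u l)\<^sup>2) = (\<Sum>m | R l m. A (l, m))"
      by (simp add: power2_eq_square mult_ac)
  qed
  have A_nonneg: "0 \<le> A (l, m)" if "R l m" for l m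
    using that by (simp add: A_def a_nonneg u_nonneg)
  have A_sum: "(A has_sum - V) ?P"
  proof (rule has_sum_SigmaI[OF fibre])
    show "((\<lambda>l. - (b l * (f l * u l)\<^sup>2)) has_sum - V) UNIV"
      using V by (simp add: has_sum_uminus)
    then show "A summable_on ?P"
      using A_nonneg by (intro summable_on_SigmaI[OF fibre]) (auto simp: summable_on_def)
  qed
  have swap: "bij_betw (\<lambda>(l, m). (m, l)) ?P ?P"
    by (rule bij_betwI[where g = "\<lambda>(l, m). (m, l)"]) (auto intro: sym)
  have "((\<lambda>p. A ((\<lambda>(l, m). (m, l)) p)) has_sum - V) ?P"
    using A_sum has_sum_reindex_bij_betw[OF swap] by blast
  then have A'_sum: "(A' has_sum - V) ?P"
  proof (rule has_sum_cong[THEN iffD1, rotated])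
    fix p assume "p \<in> ?P"
    then obtain l m where "p = (l, m)" "R l m" by auto
    then show "A ((\<lambda>(l, m). (m, l)) p) = A' p"
      using a_sym[of l m] by (simp add: A_def A'_def mult_ac)
  qed
  have square: "A p + A' p + (-2) * C p = (\<lambda>(l, m). a l m * u l * u m * (f l - f m)\<^sup>2) p" for p
    by (cases p) (simp add: A_def A'_def C_def power2_eq_square algebra_simps)
  have "C summable_on ?P"
  proof (rule summable_on_iff_abs_summable_on_real[THEN iffD2], rule summable_on_comparison_test)
    show "(\<lambda>p. A p + A' p) summable_on ?P"
      using A_sum A'_sum by (intro summable_on_add) (auto simp: summable_on_def)
    show "norm (C p) \<le> A p + A' p" if "p \<in> ?P" for p
    proof -
      obtain l m where p: "p = (l, m)" "R l m" using \<open>p \<in> ?P\<close> by auto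
      then have w: "0 \<le> a l m * u l * u m" by (simp add: a_nonneg u_nonneg)
      have "\<bar>f l * f m\<bar> \<le> (f l)\<^sup>2 + (f m)\<^sup>2"
        using sum_squares_bound[of "\<bar>f l\<bar>" "\<bar>f m\<bar>"] abs_ge_zero[of "f l * f m"]
        unfolding abs_mult power2_abs by linarith
      with w have "a l m * u l * u m * \<bar>f l * f m\<bar> \<le> a l m * u l * u m * ((f l)\<^sup>2 + (f m)\<^sup>2)"
        by (rule mult_left_mono[rotated])
      moreover have "norm (C p) = a l m * u l * u m * \<bar>f l * f m\<bar>"
      proof -
        have "C p = a l m * u l * u m * (f l * f m)" by (simp add: p C_def mult_ac)
        then show ?thesis
          by (simp only: real_norm_def abs_mult[of "a l m * u l * u m"] abs_of_nonneg[OF w])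
      qed
      ultimately show ?thesis by (simp add: p A_def A'_def algebra_simps)
    qed
  qed auto
  then obtain S where S: "(C has_sum S) ?P" by (auto simp: summable_on_def)
  have "((\<lambda>l. \<Sum>m | R l m. C (l, m)) has_sum S) UNIV"
    using S by (rule has_sum_SigmaD) (simp add: fin)
  from has_sum_add[OF this V]
  have "((\<lambda>l. - ((\<Sum>m | R l m. C (l, m)) + b l * (f l * u l)\<^sup>2)) has_sum - (S + V)) UNIV"
    by (simp only: has_sum_uminus minus_minus)
  moreover have "(\<Sum>m | R l m. C (l, m)) + b l * (f l * u l)\<^sup>2
      = f l * u l * ((\<Sum>m | R l m. a l m * (f m * u m)) + b l * (f l * u l))" for l
    by (simp add: C_def distrib_left sum_distrib_left power2_eq_square mult_ac)
  ultimately have energy: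
    "((\<lambda>l. - (f l * u l * ((\<Sum>m | R l m. a l m * (f m * u m)) + b l * (f l * u l)))) has_sum - (S + V)) UNIV"
    by simp
  have "((\<lambda>p. A p + A' p + (-2) * C p) has_sum - V + - V + (-2) * S) ?P"
    by (intro has_sum_add has_sum_cmult_right A_sum A'_sum S)
  then have "((\<lambda>(l, m). a l m * u l * u m * (f l - f m)\<^sup>2) has_sum 2 * - (S + V)) ?P"
    unfolding square by (simp add: algebra_simps)
  with energy show thesis by (rule that)
qed

theorem theorem3p2:
  fixes a :: "int ^ 'n \<Rightarrow> int ^ 'n \<Rightarrow> real"
    and b u f :: "int ^ 'n \<Rightarrow> real"
  assumes "jacobi_parameters a b"
    and "\<And>l. u l > 0"
    and "\<And>l. (\<Sum>m | nearest_neighbor l m. a l m * u m) + b l * u l = 0"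
    and "(\<lambda>l. complex_of_real (f l * u l)) \<in> ell2"
  shows "pair_value (\<lambda>l m. a l m * u l * u m * (f l - f m)\<^sup>2) summable_on nn_pairs \<and>
    ell2_inner (\<lambda>l. complex_of_real (f l * u l))
        (\<lambda>l. - jacobi_op a b (\<lambda>k. complex_of_real (f k * u k)) l) =
      complex_of_real
        (\<Sum>\<^sub>\<infinity>e\<in>nn_pairs. pair_value (\<lambda>l m. a l m * u l * u m * (f l - f m)\<^sup>2) e)"
proof -
  let ?G = "\<lambda>l m. a l m * u l * u m * (f l - f m)\<^sup>2"
  obtain B where B: "\<bar>b l\<bar> \<le> B" for l
    using assms(1) by (fastforce simp: jacobi_parameters_def bounded_iff)
  have a: "a l m = a m l" "0 \<le> a l m" if "nearest_neighbor l m" for l m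
    using assms(1) that by (auto simp: jacobi_parameters_def less_imp_le)
  have g: "(\<lambda>l. (f l * u l)\<^sup>2) summable_on UNIV"
    using assms(4) unfolding ell2_def mem_Collect_eq norm_of_real power2_abs .
  have pot: "(\<lambda>l. b l * (f l * u l)\<^sup>2) summable_on UNIV"
  proof (rule summable_on_iff_abs_summable_on_real[THEN iffD2], rule summable_on_comparison_test)
    show "(\<lambda>l. B * (f l * u l)\<^sup>2) summable_on UNIV"
      by (rule summable_on_cmult_right[OF g])
    show "norm (b l * (f l * u l)\<^sup>2) \<le> B * (f l * u l)\<^sup>2" for l
      unfolding real_norm_def abs_mult abs_power2 by (intro mult_right_mono B) simp
  qed auto
  have nn: "nearest_neighbor m l" if "nearest_neighbor l m" for l m :: "int ^ 'n"
    using that nearest_neighbor_sym by blast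
  obtain T where
    energy: "((\<lambda>l. - (f l * u l * ((\<Sum>m | nearest_neighbor l m. a l m * (f m * u m))
        + b l * (f l * u l)))) has_sum T) UNIV" and
    pairs: "((\<lambda>(l, m). ?G l m) has_sum 2 * T) (SIGMA l:UNIV. {m. nearest_neighbor l m})"
    by (rule ground_state_ordered_pairs[where R = nearest_neighbor,
          OF nn finite_neighbors a less_imp_le[OF assms(2)] assms(3) pot])
  have edges: "(pair_value ?G has_sum T) nn_pairs"
    unfolding nn_pairs_def
  proof (rule has_sum_unordered_pairs[OF nn _ _ pairs])
    show "\<not> nearest_neighbor l l" for l :: "int ^ 'n" using nearest_neighbor_neq by blast
    show "?G l m = ?G m l" if "nearest_neighbor l m" for l m
      using a(1)[OF that] by (simp add: power2_commute mult_ac)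
  qed
  have "ell2_inner (\<lambda>l. complex_of_real (f l * u l))
        (\<lambda>l. - jacobi_op a b (\<lambda>k. complex_of_real (f k * u k)) l) = complex_of_real T"
    unfolding ell2_inner_def
  proof (rule infsumI, rule has_sum_cong[THEN iffD1, OF _ has_sum_of_real[OF energy]])
    show "complex_of_real (- (f l * u l * ((\<Sum>m | nearest_neighbor l m. a l m * (f m * u m))
        + b l * (f l * u l)))) = cnj (complex_of_real (f l * u l)) *
        - jacobi_op a b (\<lambda>k. complex_of_real (f k * u k)) l" for l
      by (simp add: jacobi_op_def algebra_simps)
  qed
  with edges show ?thesis by (auto simp: summable_on_def infsumI)
qed

end
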